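(* Let $p\geq 5$ be a fixed prime. There is a constant $C_p$ depending only on $p$ such that for any positive integer $n$ and any subset $A\subseteq \mathbb{F}_p^{n}$ which does not contain $p$ distinct elements $x_1,\dots,x_p\in A$ with $x_1+\dots+x_p=0$, we have \[\vert A\vert \leq C_p\cdot \left(\sqrt{\gamma_p\cdot p}\right)^n< C_p\cdot \left(2\sqrt{p}\right)^n.\]
   Context: For a prime $p$, $\gamma_p=\min_{0<t<1}\frac{1+t+\dots+t^{p-1}}{t^{(p-1)/p}}$. *)

theory Defs
  imports Complex_Main "HOL-Library.FuncSet" "HOL-Number_Theory.Residues"
begin

abbreviation Fp :: "nat \<Rightarrow> int ring" where
  "Fp p \<equiv> residue_ring (int p)"

(* Coordinates are indexed by 1, ..., n; PiE makes the functions undefined off this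
   range, so that distinct vectors correspond exactly to distinct functions. *)
definition Fp_vectors :: "nat \<Rightarrow> nat \<Rightarrow> (nat \<Rightarrow> int) set" where
  "Fp_vectors p n = {1..n} \<rightarrow>\<^sub>E carrier (Fp p)"

definition has_zero_sum :: "nat \<Rightarrow> nat \<Rightarrow> (nat \<Rightarrow> nat \<Rightarrow> int) \<Rightarrow> bool" where
  "has_zero_sum p n x \<longleftrightarrow>
     (\<forall>i\<in>{1..n}. (\<Oplus>\<^bsub>Fp p\<^esub>j\<in>{1..p}. x j i) = \<zero>\<^bsub>Fp p\<^esub>)"

(* On the reals LEAST is the minimum when it is attained. It is for p \<ge> 3: the function
   tends to infinity at 0 and has positive derivative at 1. For p = 2 it is not attained
   and the value is unspecified. *)
definition gamma_p :: "nat \<Rightarrow> real" where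
  "gamma_p p = (LEAST y. \<exists>t. 0 < t \<and> t < 1 \<and>
     y = (\<Sum>k=0..p-1. t ^ k) / t powr ((real p - 1) / real p))"

end

theory Submission
  imports Defs "HOL-Library.Disjoint_Sets"
begin

text \<open>
  Write \<open>A\<close> for the set, and suppose that it is large. By induction on \<open>k\<close>, it contains a zero-sum
  \<open>p\<close>-tuple with at least \<open>k\<close> distinct entries. For the step, take greedily many pairwise
  disjoint zero-sum tuples in \<open>A\<close>, each with its first \<open>k\<close> entries distinct. Call a pair \<open>(x, y)\<close>
  popular if \<open>x + y\<close> has at least \<open>2 p + 2\<close> representations as a sum of two elements of \<open>A\<close>; at most
  \<open>(2 p + 2) p\<^sup>n\<close> pairs are unpopular. If \<open>\<bar>A\<bar>\<^sup>2\<close> is a large multiple of \<open>\<gamma>\<^sup>n p\<^sup>n\<close>, a Turan-type argument gives more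
  than \<open>p \<gamma>\<^sup>n\<close> of the tuples such that entries of different tuples always form popular pairs.
  By the multi-coloured sum-free theorem (slice rank) there is a zero-sum tuple \<open>z\<close> whose \<open>i\<close>-th entry
  is the \<open>i\<close>-th entry of a chosen tuple \<open>f i\<close>, with \<open>f\<close> not constant. Its first \<open>k\<close> entries are distinct. If
  \<open>z a = z b\<close> with \<open>a \<noteq> b\<close>, then \<open>f a = f b\<close>, and some \<open>f c\<close> differs from it; replacing the popular pair
  \<open>(z a, z c)\<close> by a fresh pair with the same sum keeps the value \<open>z b\<close> and adds two new ones, for the loss of
  at most \<open>z c\<close>.
\<close>

section \<open>The multi-coloured sum-free theorem\<close>

text \<open>
  Linear algebra over the field with \<open>p\<close> elements is done with integers modulo \<open>p\<close>. The set \<open>F\<close> consists of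
  free coordinates of the solution space of the \<open>card M\<close> linear equations, and the \<open>e f\<close> are the corresponding basis vectors.
\<close>

lemma free_set_mod:
  fixes p :: int and w :: "'m \<Rightarrow> 'j \<Rightarrow> int"
  assumes "prime p" "finite J" "finite M" "S \<subseteq> J"
  shows "\<exists>F e. F \<subseteq> S \<and> card S \<le> card F + card M
    \<and> (\<forall>f\<in>F. \<forall>m\<in>M. p dvd (\<Sum>j\<in>J. e f j * w m j))
    \<and> (\<forall>f\<in>F. \<forall>g\<in>F. e f g = of_bool (f = g)) \<and> (\<forall>f\<in>F. \<forall>j. j \<notin> S \<longrightarrow> e f j = 0)"
  using \<open>finite M\<close>
proof (induction M)
  case empty
  show ?case
    using assms(4) by (intro exI[of _ S] exI[of _ "\<lambda>f j. of_bool (f = j)"]) auto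
next
  case (insert m M)
  then obtain F e where F: "F \<subseteq> S" "card S \<le> card F + card M"
    "\<forall>f\<in>F. \<forall>m\<in>M. p dvd (\<Sum>j\<in>J. e f j * w m j)"
    "\<forall>f\<in>F. \<forall>g\<in>F. e f g = of_bool (f = g)" "\<forall>f\<in>F. \<forall>j. j \<notin> S \<longrightarrow> e f j = 0"
    by (elim exE conjE) (rule that)
  have fin: "finite F"
    using F(1) assms(2,4) by (meson finite_subset)
  define E where "E f = (\<Sum>j\<in>J. e f j * w m j)" for f
  show ?case
  proof (cases "\<forall>f\<in>F. p dvd E f")
    case True
    then show ?thesis
      using F insert.hyps by (intro exI[of _ F] exI[of _ e]) (auto simp: E_def)
  next
    case False
    then obtain f0 where f0: "f0 \<in> F" "\<not> p dvd E f0" by auto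
    \<comment> \<open>A pivot step: \<open>E f0\<close> is invertible modulo \<open>p\<close>, so
      subtracting a multiple of \<open>e f0\<close> from each other vector makes the new equation
      hold. Only \<open>f0\<close> is lost, and \<open>e f0\<close> vanishes at the other free
      coordinates, so the identity pattern on them survives.\<close>
    have "coprime (E f0) p"
      using prime_imp_coprime[OF \<open>prime p\<close> f0(2)] by (simp add: coprime_commute)
    then obtain b where b: "[E f0 * b = 1] (mod p)"
      using cong_solve_coprime_int by blast
    define e' where "e' f j = e f j - E f * b * e f0 j" for f j
    have lin: "(\<Sum>j\<in>J. e' f j * w l j)
        = (\<Sum>j\<in>J. e f j * w l j) - E f * b * (\<Sum>j\<in>J. e f0 j * w l j)" for f l
      by (simp add: e'_def left_diff_distrib sum_subtractf sum_distrib_left mult.assoc)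
    have dvd: "p dvd (\<Sum>j\<in>J. e' f j * w l j)" if "f \<in> F - {f0}" "l \<in> insert m M" for f l
    proof (cases "l = m")
      case True
      have "(\<Sum>j\<in>J. e' f j * w l j) = - E f * (E f0 * b - 1)"
        unfolding lin True E_def[symmetric] by (simp add: algebra_simps)
      moreover have "p dvd E f0 * b - 1"
        using b by (simp add: cong_iff_dvd_diff)
      ultimately show ?thesis by simp
    next
      case False
      then show ?thesis
        unfolding lin using F(3) that f0(1) by (intro dvd_diff dvd_mult) auto
    qed
    have "card F = Suc (card (F - {f0}))"
      using fin f0(1) by (rule card.remove)
    then have "card S \<le> card (F - {f0}) + card (insert m M)"
      using F(2) insert.hyps by simp
    moreover have "e' f g = of_bool (f = g)" if "f \<in> F - {f0}" "g \<in> F - {f0}" for f g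
      using F(4) f0(1) that unfolding e'_def by auto
    moreover have "e' f j = 0" if "f \<in> F - {f0}" "j \<notin> S" for f j
      using F(5) f0(1) that unfolding e'_def by auto
    ultimately show ?thesis
      using F(1) dvd by (intro exI[of _ "F - {f0}"] exI[of _ e'] conjI ballI allI impI) auto
  qed
qed

text \<open>Each system costs at most \<open>card M\<close> free coordinates, chosen inside the set
  left by the earlier systems. The sum of its basis vectors solves the system and is 1 on all
  surviving coordinates; the earlier solutions remain 1 on the smaller set.\<close>

lemma common_free_set_mod:
  fixes p :: int and w :: "nat \<Rightarrow> 'm \<Rightarrow> 'j \<Rightarrow> int"
  assumes "prime p" "finite J" "finite M"
  shows "\<exists>F h. F \<subseteq> J \<and> card J \<le> card F + d * card M \<and>
    (\<forall>i\<in>{1..d}. (\<forall>m\<in>M. p dvd (\<Sum>j\<in>J. h i j * w i m j)) \<and> (\<forall>f\<in>F. h i f = 1))"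
proof (induction d)
  case 0
  show ?case by auto
next
  case (Suc d)
  then obtain F h where F: "F \<subseteq> J" "card J \<le> card F + d * card M"
    "\<forall>i\<in>{1..d}. (\<forall>m\<in>M. p dvd (\<Sum>j\<in>J. h i j * w i m j)) \<and> (\<forall>f\<in>F. h i f = 1)"
    by (elim exE conjE) (rule that)
  obtain G e where G: "G \<subseteq> F" "card F \<le> card G + card M"
    "\<forall>f\<in>G. \<forall>m\<in>M. p dvd (\<Sum>j\<in>J. e f j * w (Suc d) m j)"
    "\<forall>f\<in>G. \<forall>g\<in>G. e f g = of_bool (f = g)"
    using free_set_mod[OF assms(1-3) F(1), of "w (Suc d)"]
    by (elim exE conjE) (rule that)
  have fin: "finite G"
    by (rule finite_subset[OF G(1) finite_subset[OF F(1) assms(2)]])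
  define h' where "h' = h(Suc d := (\<lambda>j. \<Sum>f\<in>G. e f j))"
  have 1: "p dvd (\<Sum>j\<in>J. h' (Suc d) j * w (Suc d) m j)" if "m \<in> M" for m
  proof -
    have "(\<Sum>j\<in>J. h' (Suc d) j * w (Suc d) m j) = (\<Sum>j\<in>J. \<Sum>f\<in>G. e f j * w (Suc d) m j)"
      unfolding h'_def by (simp add: sum_distrib_right)
    also have "\<dots> = (\<Sum>f\<in>G. \<Sum>j\<in>J. e f j * w (Suc d) m j)"
      by (rule sum.swap)
    finally show ?thesis using G(3) that by (simp add: dvd_sum)
  qed
  have 2: "h' (Suc d) g = 1" if "g \<in> G" for g
  proof -
    have "(\<Sum>f\<in>G. e f g) = (\<Sum>f\<in>G. of_bool (f = g))"
      using G(4) that by (intro sum.cong) auto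
    then show ?thesis
      using that fin unfolding h'_def by (simp add: of_bool_def)
  qed
  have 3: "h' i = h i" if "i \<in> {1..d}" for i
    using that by (auto simp: h'_def)
  have "(\<forall>m\<in>M. p dvd (\<Sum>j\<in>J. h' i j * w i m j)) \<and> (\<forall>f\<in>G. h' i f = 1)"
    if "i \<in> {1..Suc d}" for i
  proof (cases "i = Suc d")
    case True
    then show ?thesis using 1 2 by simp
  next
    case False
    then have "i \<in> {1..d}" using that by auto
    then show ?thesis using F(3) G(1) 3 by auto
  qed
  then show ?case
    using F(1,2) G(1,2) by (intro exI[of _ G] exI[of _ h'] conjI ballI) auto
qed

text \<open>
  The lower bound for the slice rank of a diagonal tensor: the weights annihilate all slices, but not the diagonal.
\<close>

lemma separating_weights_mod:
  fixes p :: int and w :: "nat \<Rightarrow> 'm \<Rightarrow> 'j \<Rightarrow> int"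
  assumes "prime p" "finite J" "finite M" "d \<ge> 2" "card J > d * card M"
  shows "\<exists>h. (\<forall>i\<in>{1..d}. \<forall>m\<in>M. p dvd (\<Sum>j\<in>J. h i j * w i m j))
    \<and> (\<Sum>j\<in>J. \<Prod>i\<in>{1..d}. h i j) = 1"
proof -
  \<comment> \<open>The last two weights play special roles: the first \<open>k\<close> are 1 on
    \<open>F\<close>, the next restricts to the indicator of one point on \<open>G\<close>, and the
    last is supported on \<open>G\<close>.\<close>
  obtain k where d: "d = Suc (Suc k)"
    using le_Suc_ex[OF \<open>d \<ge> 2\<close>] by auto
  obtain F h where F: "F \<subseteq> J" "card J \<le> card F + k * card M"
    "\<forall>i\<in>{1..k}. (\<forall>m\<in>M. p dvd (\<Sum>j\<in>J. h i j * w i m j)) \<and> (\<forall>f\<in>F. h i f = 1)"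
    using common_free_set_mod[OF assms(1-3), of k w] by (elim exE conjE) (rule that)
  obtain G e where G: "G \<subseteq> F" "card F \<le> card G + card M"
    "\<forall>f\<in>G. \<forall>m\<in>M. p dvd (\<Sum>j\<in>J. e f j * w (Suc k) m j)"
    "\<forall>f\<in>G. \<forall>g\<in>G. e f g = of_bool (f = g)"
    using free_set_mod[OF assms(1-3) F(1), of "w (Suc k)"] by (elim exE conjE) (rule that)
  obtain H e' where H: "H \<subseteq> G" "card G \<le> card H + card M"
    "\<forall>f\<in>H. \<forall>m\<in>M. p dvd (\<Sum>j\<in>J. e' f j * w (Suc (Suc k)) m j)"
    "\<forall>f\<in>H. \<forall>g\<in>H. e' f g = of_bool (f = g)" "\<forall>f\<in>H. \<forall>j. j \<notin> G \<longrightarrow> e' f j = 0"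
    using free_set_mod[OF assms(1-3) order_trans[OF G(1) F(1)], of "w (Suc (Suc k))"]
    by (elim exE conjE) (rule that)
  \<comment> \<open>The nested choices lose at most \<open>d * card M\<close> coordinates in total,
    fewer than \<open>card J\<close>.\<close>
  have "card H > 0"
    using assms(5) F(2) G(2) H(2) unfolding d by auto
  then obtain f where f: "f \<in> H" by fastforce
  define h' where "h' = h(Suc k := e f, Suc (Suc k) := e' f)"
  have eqs: "h' (Suc k) = e f" "h' (Suc (Suc k)) = e' f" "\<And>i. i \<in> {1..k} \<Longrightarrow> h' i = h i"
    by (auto simp: h'_def)
  have 1: "p dvd (\<Sum>j\<in>J. h' i j * w i m j)" if "i \<in> {1..d}" "m \<in> M" for i m
  proof -
    consider "i \<in> {1..k}" | "i = Suc k" | "i = Suc (Suc k)" using \<open>i \<in> {1..d}\<close> d by fastforce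
    then show ?thesis using F(3) G(3) H(1,3) f eqs \<open>m \<in> M\<close> by cases auto
  qed
  \<comment> \<open>On \<open>G\<close> the first \<open>k\<close> factors are 1 and the next is the
    indicator of \<open>f\<close>; off \<open>G\<close> the last factor vanishes.\<close>
  have "(\<Prod>i\<in>{1..d}. h' i j) = of_bool (j = f)" for j
  proof (cases "j \<in> G")
    case True
    have "(\<Prod>i\<in>{1..k}. h' i j) = 1"
      using eqs F(3) True G(1) by (intro prod.neutral) auto
    moreover have "e f j = of_bool (j = f)" "e' f f = 1"
      using True G(4) H(1,4) f by auto
    ultimately show ?thesis
      using eqs unfolding d by auto
  next
    case False
    then have "e' f j = 0" "j \<noteq> f" using H(1,5) f by auto
    then show ?thesis
      using eqs unfolding d by auto
  qed
  then have "(\<Sum>j\<in>J. \<Prod>i\<in>{1..d}. h' i j) = 1"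
    using f F(1) G(1) H(1) \<open>finite J\<close> by (auto simp: of_bool_def)
  with 1 show ?thesis by blast
qed

section \<open>Expanding the indicator of a zero sum into monomials\<close>

lemma power_sum_eq_sum_PiE:
  fixes x :: "'i \<Rightarrow> 'a :: comm_semiring_1"
  assumes "finite I"
  shows "(\<Sum>i\<in>I. x i) ^ d = (\<Sum>f\<in>{..<d} \<rightarrow>\<^sub>E I. \<Prod>i\<in>I. x i ^ card {k \<in> {..<d}. f k = i})"
proof -
  have "(\<Sum>i\<in>I. x i) ^ d = (\<Prod>k\<in>{..<d}. \<Sum>i\<in>I. x i)"
    by simp
  also have "\<dots> = (\<Sum>f\<in>{..<d} \<rightarrow>\<^sub>E I. \<Prod>k\<in>{..<d}. x (f k))"
    by (rule prod_sum_PiE) (use assms in auto)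
  also have "\<dots> = (\<Sum>f\<in>{..<d} \<rightarrow>\<^sub>E I. \<Prod>i\<in>I. x i ^ card {k \<in> {..<d}. f k = i})"
  proof (rule sum.cong[OF refl])
    fix f assume f: "f \<in> {..<d} \<rightarrow>\<^sub>E I"
    have "(\<Prod>k\<in>{..<d}. x (f k)) = (\<Prod>i\<in>I. \<Prod>k\<in>{k \<in> {..<d}. f k = i}. x (f k))"
      using assms f by (intro prod.group[symmetric]) auto
    also have "\<dots> = (\<Prod>i\<in>I. x i ^ card {k \<in> {..<d}. f k = i})"
      by (intro prod.cong refl) simp
    finally show "(\<Prod>k\<in>{..<d}. x (f k)) = (\<Prod>i\<in>I. x i ^ card {k \<in> {..<d}. f k = i})" .
  qed
  finally show ?thesis .
qed

text \<open>The monomials are indexed by words: \<open>None\<close> stands for the constant 1 and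
  \<open>Some f\<close> for the product along a word \<open>f\<close> of length \<open>d\<close>.
  Keeping equal monomials apart avoids multinomial coefficients. For \<open>d = p - 1\<close> the
  left side is, modulo \<open>p\<close>, the indicator of a vanishing sum.\<close>

lemma one_minus_power_sum_expansion:
  assumes "finite (I :: 'i set)"
  shows "\<exists>(Q :: (nat \<Rightarrow> 'i) option set) (c :: _ \<Rightarrow> int) a. finite Q \<and> (\<forall>q\<in>Q. (\<Sum>i\<in>I. a q i) \<le> d) \<and>
    (\<forall>x. 1 - (\<Sum>i\<in>I. x i) ^ d = (\<Sum>q\<in>Q. c q * (\<Prod>i\<in>I. x i ^ a q i)))"
proof -
  define P where "P = {..<d} \<rightarrow>\<^sub>E I"
  define a where "a q i = (case q of None \<Rightarrow> 0 | Some f \<Rightarrow> card {k \<in> {..<d}. f k = i})"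
    for q :: "(nat \<Rightarrow> 'i) option" and i
  define c :: "(nat \<Rightarrow> 'i) option \<Rightarrow> int" where "c q = (case q of None \<Rightarrow> 1 | Some _ \<Rightarrow> - 1)" for q
  have fin: "finite P"
    unfolding P_def using assms by (intro finite_PiE) auto
  show ?thesis
  proof (rule exI[of _ "insert None (Some ` P)"], rule exI[of _ c], rule exI[of _ a], intro conjI ballI allI)
    show "finite (insert None (Some ` P))" using fin by simp
    show "(\<Sum>i\<in>I. a q i) \<le> d" if q: "q \<in> insert None (Some ` P)" for q
    proof (cases q)
      case None
      then show ?thesis by (simp add: a_def)
    next
      case (Some f)
      then have "f ` {..<d} \<subseteq> I" using q unfolding P_def by auto
      then have "(\<Sum>i\<in>I. \<Sum>k\<in>{k \<in> {..<d}. f k = i}. 1) = (\<Sum>k\<in>{..<d}. 1 :: nat)"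
        using assms by (intro sum.group) auto
      then show ?thesis using Some by (simp add: a_def)
    qed
    show "1 - (\<Sum>i\<in>I. x i) ^ d = (\<Sum>q\<in>insert None (Some ` P). c q * (\<Prod>i\<in>I. x i ^ a q i))"
      for x :: "'i \<Rightarrow> int"
      using fin unfolding power_sum_eq_sum_PiE[OF assms] P_def[symmetric]
      by (subst sum.insert) (auto simp: a_def c_def sum.reindex sum_negf)
  qed
qed

text \<open>Exponents of the monomials that serve as slices: the degree is at most a
  \<open>1 / p\<close> share of the total degree \<open>n * (p - 1)\<close> of the indicator
  polynomial. The bound is multiplied out to stay in the natural numbers.\<close>

definition low_exponents :: "nat \<Rightarrow> nat \<Rightarrow> (nat \<Rightarrow> nat) set" where
  "low_exponents p n = {e \<in> {1..n} \<rightarrow>\<^sub>E {0..p - 1}. p * (\<Sum>c\<in>{1..n}. e c) \<le> n * (p - 1)}"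

lemma finite_low_exponents: "finite (low_exponents p n)"
  unfolding low_exponents_def by (rule finite_subset[of _ "{1..n} \<rightarrow>\<^sub>E {0..p - 1}"]) (auto intro!: finite_PiE)

lemma fermat_mod_int:
  fixes a :: int
  assumes "prime p" "\<not> int p dvd a"
  shows "[a ^ (p - 1) = 1] (mod int p)"
proof -
  have p: "p > 1" using assms(1) prime_gt_1_nat by blast
  define b where "b = nat (a mod int p)"
  have b: "int b = a mod int p" using p by (simp add: b_def)
  have "\<not> p dvd b"
    using assms(2) b by (metis dvd_mod_iff dvd_refl int_dvd_int_iff)
  from fermat_theorem[OF assms(1) this] have "[int b ^ (p - 1) = 1] (mod int p)"
    by (metis cong_int_iff of_nat_1 of_nat_power)
  then show ?thesis unfolding b by (simp add: cong_def power_mod)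
qed

text \<open>If only constant choices \<open>f\<close> gave a zero sum, the indicator of zero sums
  would be a diagonal tensor modulo \<open>p\<close>. Its contraction with weights that annihilate
  all low-degree monomials would be 1. But every monomial of the indicator has low degree in one of
  the \<open>p\<close> blocks of variables, so the contraction is 0 modulo \<open>p\<close>.\<close>

theorem multicolored_zero_sum:
  fixes y :: "nat \<Rightarrow> 'j \<Rightarrow> nat \<Rightarrow> int"
  assumes "prime p" "finite J" "card J > p * card (low_exponents p n)"
    and diag: "\<forall>j\<in>J. \<forall>c\<in>{1..n}. int p dvd (\<Sum>i\<in>{1..p}. y i j c)"
  shows "\<exists>f \<in> {1..p} \<rightarrow> J. (\<forall>c\<in>{1..n}. int p dvd (\<Sum>i\<in>{1..p}. y i (f i) c)) \<and>
    (\<exists>a\<in>{1..p}. \<exists>b\<in>{1..p}. f a \<noteq> f b)"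
proof (rule ccontr)
  assume no: "\<not> ?thesis"
  let ?I = "{1..p}" and ?N = "{1..n}"
  have p: "p \<ge> 2" using assms(1) prime_ge_2_nat by blast
  obtain h where h: "\<forall>i\<in>?I. \<forall>e\<in>low_exponents p n.
      int p dvd (\<Sum>j\<in>J. h i j * (\<Prod>c\<in>?N. y i j c ^ e c))"
    and h1: "(\<Sum>j\<in>J. \<Prod>i\<in>?I. h i j) = 1"
    using separating_weights_mod[of "int p" J "low_exponents p n" p "\<lambda>i e j. \<Prod>c\<in>?N. y i j c ^ e c"]
      assms(1-3) finite_low_exponents p by auto
  obtain Q :: "(nat \<Rightarrow> nat) option set" and coef :: "_ \<Rightarrow> int" and a where Q: "finite Q"
    "\<forall>q\<in>Q. (\<Sum>i\<in>?I. a q i) \<le> p - 1"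
    "\<forall>x. 1 - (\<Sum>i\<in>?I. x i) ^ (p - 1) = (\<Sum>q\<in>Q. coef q * (\<Prod>i\<in>?I. x i ^ a q i))"
    using one_minus_power_sum_expansion[OF finite_atLeastAtMost, of 1 p "p - 1"]
    by (elim exE conjE) (rule that)
  \<comment> \<open>By Fermat's little theorem \<open>P f\<close> is, modulo \<open>p\<close>, the
    indicator that the vectors chosen by \<open>f\<close> sum to zero. \<open>S\<close> contracts
    this tensor with the weights and is evaluated in two ways.\<close>
  define P where "P f = (\<Prod>c\<in>?N. 1 - (\<Sum>i\<in>?I. y i (f i) c) ^ (p - 1))" for f
  define S where "S = (\<Sum>f\<in>?I \<rightarrow>\<^sub>E J. (\<Prod>i\<in>?I. h i (f i)) * P f)"
  have finPi: "finite (?I \<rightarrow>\<^sub>E J)" using assms(2) by (intro finite_PiE) auto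

  have "S = (\<Sum>g\<in>?N \<rightarrow>\<^sub>E Q. (\<Prod>c\<in>?N. coef (g c)) *
      (\<Prod>i\<in>?I. \<Sum>j\<in>J. h i j * (\<Prod>c\<in>?N. y i j c ^ a (g c) i)))"
  proof -
    have P: "P f = (\<Sum>g\<in>?N \<rightarrow>\<^sub>E Q. (\<Prod>c\<in>?N. coef (g c)) * (\<Prod>i\<in>?I. \<Prod>c\<in>?N. y i (f i) c ^ a (g c) i))" for f
    proof -
      have "P f = (\<Prod>c\<in>?N. \<Sum>q\<in>Q. coef q * (\<Prod>i\<in>?I. y i (f i) c ^ a q i))"
        unfolding P_def by (simp only: Q(3))
      also have "\<dots> = (\<Sum>g\<in>?N \<rightarrow>\<^sub>E Q. \<Prod>c\<in>?N. coef (g c) * (\<Prod>i\<in>?I. y i (f i) c ^ a (g c) i))"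
        by (rule prod_sum_PiE) (use Q(1) in auto)
      also have "\<dots> = (\<Sum>g\<in>?N \<rightarrow>\<^sub>E Q. (\<Prod>c\<in>?N. coef (g c)) * (\<Prod>i\<in>?I. \<Prod>c\<in>?N. y i (f i) c ^ a (g c) i))"
        unfolding prod.distrib by (subst prod.swap) simp
      finally show ?thesis .
    qed
    have "S = (\<Sum>f\<in>?I \<rightarrow>\<^sub>E J. \<Sum>g\<in>?N \<rightarrow>\<^sub>E Q. (\<Prod>c\<in>?N. coef (g c)) *
        (\<Prod>i\<in>?I. h i (f i) * (\<Prod>c\<in>?N. y i (f i) c ^ a (g c) i)))"
      unfolding S_def P sum_distrib_left by (simp add: prod.distrib mult_ac)
    also have "\<dots> = (\<Sum>g\<in>?N \<rightarrow>\<^sub>E Q. \<Sum>f\<in>?I \<rightarrow>\<^sub>E J. (\<Prod>c\<in>?N. coef (g c)) *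
        (\<Prod>i\<in>?I. h i (f i) * (\<Prod>c\<in>?N. y i (f i) c ^ a (g c) i)))"
      by (rule sum.swap)
    also have "\<dots> = (\<Sum>g\<in>?N \<rightarrow>\<^sub>E Q. (\<Prod>c\<in>?N. coef (g c)) *
        (\<Prod>i\<in>?I. \<Sum>j\<in>J. h i j * (\<Prod>c\<in>?N. y i j c ^ a (g c) i)))"
      by (subst prod_sum_PiE) (use assms(2) in \<open>auto simp: sum_distrib_left\<close>)
    finally show ?thesis .
  qed
  also have "int p dvd \<dots>"
  proof (intro dvd_sum dvd_mult)
    fix g assume g: "g \<in> ?N \<rightarrow>\<^sub>E Q"
    have "(\<Sum>i\<in>?I. \<Sum>c\<in>?N. a (g c) i) = (\<Sum>c\<in>?N. \<Sum>i\<in>?I. a (g c) i)"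
      by (rule sum.swap)
    also have "\<dots> \<le> (\<Sum>c\<in>?N. p - 1)"
      using g Q(2) by (intro sum_mono) auto
    also have "\<dots> = n * (p - 1)" by simp
    finally have tot: "(\<Sum>i\<in>?I. \<Sum>c\<in>?N. a (g c) i) \<le> n * (p - 1)" .
    \<comment> \<open>Pigeonhole over the \<open>p\<close> blocks: the least of the block degrees is
      at most their average. The factor of that block is then annihilated by its weight.\<close>
    have "\<exists>i\<in>?I. p * (\<Sum>c\<in>?N. a (g c) i) \<le> n * (p - 1)"
    proof (rule ccontr)
      assume "\<not> ?thesis"
      then have "(\<Sum>i\<in>?I. n * (p - 1)) < (\<Sum>i\<in>?I. p * (\<Sum>c\<in>?N. a (g c) i))"
        using p by (intro sum_strict_mono) (auto simp: not_le)
      then have "p * (n * (p - 1)) < p * (\<Sum>i\<in>?I. \<Sum>c\<in>?N. a (g c) i)"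
        by (simp add: sum_distrib_left)
      then show False using tot by simp
    qed
    then obtain i where i: "i \<in> ?I" "p * (\<Sum>c\<in>?N. a (g c) i) \<le> n * (p - 1)" by blast
    define e where "e = restrict (\<lambda>c. a (g c) i) ?N"
    have "a (g c) i \<le> p - 1" if "c \<in> ?N" for c
    proof -
      have "a (g c) i \<le> (\<Sum>i\<in>?I. a (g c) i)"
        using i(1) by (intro member_le_sum) auto
      also have "\<dots> \<le> p - 1" using g that Q(2) by auto
      finally show ?thesis .
    qed
    then have "e \<in> low_exponents p n"
      using i(2) unfolding low_exponents_def e_def by auto
    with h i(1) have "int p dvd (\<Sum>j\<in>J. h i j * (\<Prod>c\<in>?N. y i j c ^ e c))" by blast
    then have "int p dvd (\<Sum>j\<in>J. h i j * (\<Prod>c\<in>?N. y i j c ^ a (g c) i))"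
      by (simp add: e_def)
    also have "\<dots> dvd (\<Prod>i\<in>?I. \<Sum>j\<in>J. h i j * (\<Prod>c\<in>?N. y i j c ^ a (g c) i))"
      using i(1) by (intro dvd_prodI) auto
    finally show "int p dvd (\<Prod>i\<in>?I. \<Sum>j\<in>J. h i j * (\<Prod>c\<in>?N. y i j c ^ a (g c) i))" .
  qed
  finally have S0: "int p dvd S" .

  \<comment> \<open>The constant choices. There \<open>P\<close> is 1 by \<open>diag\<close>, and
    elsewhere it is 0 by the assumption \<open>no\<close>, both modulo \<open>p\<close>, so
    \<open>S\<close> is congruent to the sum in \<open>h1\<close>.\<close>
  define K where "K = (\<lambda>j. restrict (\<lambda>_. j) ?I) ` J"
  have K: "K \<subseteq> ?I \<rightarrow>\<^sub>E J" unfolding K_def by auto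
  have P0: "int p dvd P f" if f: "f \<in> ?I \<rightarrow>\<^sub>E J" "f \<notin> K" for f
  proof -
    have "\<exists>a\<in>?I. \<exists>b\<in>?I. f a \<noteq> f b"
    proof (rule ccontr)
      assume const: "\<not> ?thesis"
      have "f i = f 1" if "i \<in> ?I" for i
      proof -
        have "1 \<in> ?I" using p by simp
        then show ?thesis using const that by blast
      qed
      then have "f = restrict (\<lambda>_. f 1) ?I"
        using PiE_arb[OF f(1)] by (intro ext) (simp only: restrict_apply split: if_split, blast)
      moreover have "f 1 \<in> J" using f(1) p by auto
      ultimately show False using f(2) unfolding K_def by blast
    qed
    moreover have "f \<in> ?I \<rightarrow> J" using f(1) by auto
    ultimately obtain c where c: "c \<in> ?N" "\<not> int p dvd (\<Sum>i\<in>?I. y i (f i) c)"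
      using no by blast
    have "int p dvd 1 - (\<Sum>i\<in>?I. y i (f i) c) ^ (p - 1)"
      using fermat_mod_int[OF assms(1) c(2)] by (simp add: cong_iff_dvd_diff dvd_diff_commute)
    also have "\<dots> dvd P f"
      unfolding P_def using c(1) by (intro dvd_prodI) auto
    finally show ?thesis .
  qed
  have P1: "[P f = 1] (mod int p)" if "f \<in> K" for f
  proof -
    obtain j where j: "j \<in> J" "f = restrict (\<lambda>_. j) ?I" using \<open>f \<in> K\<close> unfolding K_def by blast
    have "[P f = (\<Prod>c\<in>?N. 1)] (mod int p)"
      unfolding P_def
    proof (intro cong_prod)
      fix c assume c: "c \<in> ?N"
      have "int p dvd (\<Sum>i\<in>?I. y i (f i) c)"
        using diag j c by simp
      then have "int p dvd (\<Sum>i\<in>?I. y i (f i) c) ^ (p - 1)"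
        using p by (intro dvd_power_le[of _ _ 1, simplified]) (auto simp: dvd_power dest: dvd_trans)
      then show "[1 - (\<Sum>i\<in>?I. y i (f i) c) ^ (p - 1) = 1] (mod int p)"
        by (simp add: cong_iff_dvd_diff)
    qed
    then show ?thesis by simp
  qed
  have "[S = (\<Sum>f\<in>?I \<rightarrow>\<^sub>E J. (\<Prod>i\<in>?I. h i (f i)) * of_bool (f \<in> K))] (mod int p)"
    unfolding S_def
  proof (intro cong_sum cong_mult cong_refl)
    fix f assume "f \<in> ?I \<rightarrow>\<^sub>E J"
    then show "[P f = of_bool (f \<in> K)] (mod int p)"
      using P0[of f] P1[of f] by (cases "f \<in> K") (auto simp: cong_0_iff)
  qed
  also have "(\<Sum>f\<in>?I \<rightarrow>\<^sub>E J. (\<Prod>i\<in>?I. h i (f i)) * of_bool (f \<in> K)) = (\<Sum>f\<in>K. \<Prod>i\<in>?I. h i (f i))"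
    using K finPi by (intro sum.mono_neutral_cong_right) auto
  also have "\<dots> = (\<Sum>j\<in>J. \<Prod>i\<in>?I. h i j)"
  proof -
    have "inj_on (\<lambda>j. restrict (\<lambda>_. j) ?I) J"
    proof (rule inj_onI)
      fix j j' assume "restrict (\<lambda>_. j) ?I = restrict (\<lambda>_. j') ?I"
      from fun_cong[OF this, of 1] show "j = j'" using p by simp
    qed
    then show ?thesis unfolding K_def by (simp add: sum.reindex)
  qed
  also have "\<dots> = 1" by (rule h1)
  finally have "int p dvd 1"
    using S0 by (simp add: cong_dvd_iff)
  then show False using p by simp
qed

section \<open>The constant \<open>\<gamma>\<^sub>p\<close>\<close>

text \<open>The minimum over the compact interval from \<open>1/16\<close> to 1 is below 4 because
  the value at \<open>1/2\<close> is. Hence it is not taken at 1 and also beats the values near 0,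
  so it is the minimum over the open interval.\<close>

lemma gamma_p_attained:
  assumes "p \<ge> 5"
  obtains t where "0 < t" "t < 1"
    "gamma_p p = (\<Sum>k=0..p-1. t ^ k) / t powr ((real p - 1) / real p)"
    "1 \<le> gamma_p p" "gamma_p p < 4"
proof -
  define a where "a = (real p - 1) / real p"
  define s where "s t = (\<Sum>k=0..p-1. t ^ k)" for t :: real
  define f where "f t = s t / t powr a" for t :: real
  have a: "1 / 2 \<le> a" "a \<le> 1"
    using assms by (auto simp: a_def field_simps)
  have s_ge: "s t \<ge> 1" if "t \<ge> 0" for t
  proof -
    have "(\<Sum>k\<in>{0}. t ^ k) \<le> s t"
      unfolding s_def using that by (intro sum_mono2) auto
    then show ?thesis by simp
  qed
  have f_half: "f (1/2) < 4"
  proof -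
    have "s (1/2) = 2 - 2 * (1/2) ^ p"
      using sum_gp0[of "1/2 :: real" "p - 1"] assms
      by (simp add: s_def atLeast0AtMost field_simps)
    then have "s (1/2) < 2" by simp
    moreover have "(1/2 :: real) powr a \<ge> (1/2) powr 1"
      using a by (intro powr_mono') auto
    ultimately show ?thesis
      unfolding f_def by (simp add: divide_less_eq)
  qed
  \<comment> \<open>Below \<open>1/16\<close> the function exceeds \<open>4\<close>, and so does its value \<open>p\<close> at \<open>1\<close>.\<close>
  have cont: "continuous_on {1/16..1} f"
    unfolding f_def s_def by (intro continuous_intros) auto
  obtain t where t: "t \<in> {1/16..1}" "\<And>u. u \<in> {1/16..1} \<Longrightarrow> f t \<le> f u"
    using continuous_attains_inf[OF compact_Icc _ cont] by auto
  have t4: "f t < 4"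
    using t(2)[of "1/2"] f_half by simp
  have min: "f t \<le> f u" if u: "0 < u" "u < 1" for u
  proof (cases "u \<ge> 1/16")
    case True
    then show ?thesis using t(2) u by simp
  next
    case False
    have "u powr a \<le> u powr (1/2)"
      using u a by (intro powr_mono') auto
    also have "\<dots> \<le> (1/16) powr (1/2)"
      using u False by (intro powr_mono2) auto
    also have "\<dots> = 1/4"
      by (simp add: powr_half_sqrt real_sqrt_divide)
    finally have "1 / u powr a \<ge> 4"
      using u by (simp add: field_simps)
    also have "1 / u powr a \<le> f u"
      unfolding f_def using s_ge[of u] u by (intro divide_right_mono) auto
    finally show ?thesis using t4 by simp
  qed
  have "f 1 = p"
    using assms by (simp add: f_def s_def)
  then have "t \<noteq> 1" using t4 assms by auto
  then have t01: "0 < t" "t < 1" using t(1) by auto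
  have g: "gamma_p p = f t"
    unfolding gamma_p_def
  proof (rule Least_equality)
    show "\<exists>u. 0 < u \<and> u < 1 \<and> f t = (\<Sum>k = 0..p - 1. u ^ k) / u powr ((real p - 1) / real p)"
      using t01 unfolding f_def s_def a_def by blast
    show "f t \<le> y" if "\<exists>u. 0 < u \<and> u < 1 \<and> y = (\<Sum>k = 0..p - 1. u ^ k) / u powr ((real p - 1) / real p)" for y
      using that min unfolding f_def s_def a_def by blast
  qed
  have "t powr a \<le> 1"
    using t01 a by (intro powr_le1) auto
  then have "1 \<le> f t"
    unfolding f_def using s_ge[of t] t01 by (simp add: le_divide_eq)
  then show thesis
    using that[OF t01] g t4 unfolding f_def s_def a_def by simp
qed

text \<open>An exponential-moment bound: since \<open>t < 1\<close>, each low-degree monomial has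
  weight at least \<open>(t powr a) ^ n\<close>, with \<open>a = (p - 1) / p\<close>, while the
  weights of all exponent functions sum to the \<open>n\<close>-th power of the geometric
  sum.\<close>

lemma card_low_exponents_le:
  assumes "p > 0" "0 < t" "t < 1"
  shows "real (card (low_exponents p n)) \<le> ((\<Sum>k=0..p-1. t ^ k) / t powr ((real p - 1) / real p)) ^ n"
proof -
  define a where "a = (real p - 1) / real p"
  have le: "(t powr a) ^ n \<le> (\<Prod>c\<in>{1..n}. t ^ e c)" if "e \<in> low_exponents p n" for e
  proof -
    have "p * (\<Sum>c\<in>{1..n}. e c) \<le> n * (p - 1)"
      using that by (simp add: low_exponents_def)
    then have "real (p * (\<Sum>c\<in>{1..n}. e c)) \<le> real (n * (p - 1))"
      by (simp only: of_nat_le_iff)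
    then have "real (\<Sum>c\<in>{1..n}. e c) \<le> a * real n"
      using assms(1) by (simp add: a_def field_simps of_nat_diff)
    then have "t powr (a * real n) \<le> t powr real (\<Sum>c\<in>{1..n}. e c)"
      using assms by (intro powr_mono') auto
    also have "\<dots> = (\<Prod>c\<in>{1..n}. t ^ e c)"
      using assms by (simp only: powr_realpow power_sum)
    finally show ?thesis
      using assms by (simp add: powr_powr[symmetric] powr_realpow)
  qed
  have "real (card (low_exponents p n)) * (t powr a) ^ n = (\<Sum>e\<in>low_exponents p n. (t powr a) ^ n)"
    by simp
  also have "\<dots> \<le> (\<Sum>e\<in>low_exponents p n. \<Prod>c\<in>{1..n}. t ^ e c)"
    by (intro sum_mono le)
  also have "\<dots> \<le> (\<Sum>e\<in>{1..n} \<rightarrow>\<^sub>E {0..p-1}. \<Prod>c\<in>{1..n}. t ^ e c)"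
    using assms by (intro sum_mono2 finite_PiE prod_nonneg) (auto simp: low_exponents_def)
  also have "\<dots> = (\<Prod>c\<in>{1..n}. \<Sum>k=0..p-1. t ^ k)"
    by (rule prod_sum_PiE[symmetric]) auto
  also have "\<dots> = (\<Sum>k=0..p-1. t ^ k) ^ n" by simp
  finally show ?thesis
    using assms by (simp add: power_divide le_divide_eq flip: a_def)
qed

lemma card_low_exponents_le_gamma_p:
  assumes "p \<ge> 5"
  shows "real (card (low_exponents p n)) \<le> gamma_p p ^ n"
proof -
  obtain t where t: "0 < t" "t < 1"
    "gamma_p p = (\<Sum>k=0..p-1. t ^ k) / t powr ((real p - 1) / real p)"
    using gamma_p_attained[OF assms] by metis
  show ?thesis
    using card_low_exponents_le[of p t n] assms t by simp
qed

section \<open>Popular sums\<close>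

text \<open>By Markov's inequality at least half of the vertices lie in \<open>W\<close>, where the
  degree is at most twice the average. The closed neighbourhoods of a maximal independent subset of
  \<open>W\<close> cover \<open>W\<close>. Ordered pairs are counted, loops included, so
  \<open>r\<close> need not be irreflexive.\<close>

lemma large_independent_set:
  assumes "finite T" "symp r"
  shows "\<exists>I\<subseteq>T. (\<forall>x\<in>I. \<forall>y\<in>I. x \<noteq> y \<longrightarrow> \<not> r x y) \<and>
    card T ^ 2 \<le> card I * (2 * card T + 4 * card {(x, y) \<in> T \<times> T. r x y})"
proof -
  define N where "N x = {y \<in> T. r x y}" for x
  define E where "E = card {(x, y) \<in> T \<times> T. r x y}"
  define W where "W = {x \<in> T. card T * card (N x) \<le> 2 * E}"
  have finN: "finite (N x)" for x unfolding N_def using assms(1) by simp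
  have finW: "finite W" unfolding W_def using assms(1) by simp
  have E: "E = (\<Sum>x\<in>T. card (N x))"
  proof -
    have "{(x, y) \<in> T \<times> T. r x y} = (SIGMA x:T. N x)" by (auto simp: N_def)
    then show ?thesis unfolding E_def using assms(1) finN by simp
  qed
  have half: "card T \<le> 2 * card W"
  proof (cases "E = 0")
    case True
    then have "W = T" using E assms(1) by (auto simp: W_def)
    then show ?thesis by simp
  next
    case False
    have "card (T - W) * (2 * E) = (\<Sum>x\<in>T - W. 2 * E)" by simp
    also have "\<dots> \<le> (\<Sum>x\<in>T - W. card T * card (N x))"
      by (intro sum_mono) (auto simp: W_def)
    also have "\<dots> \<le> (\<Sum>x\<in>T. card T * card (N x))"
      using assms(1) by (intro sum_mono2) auto
    also have "\<dots> = card T * E" by (simp add: E sum_distrib_left)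
    finally have "2 * card (T - W) \<le> card T" using False by simp
    moreover have "card (T - W) = card T - card W" "card W \<le> card T"
      using assms(1) by (auto simp: W_def card_Diff_subset card_mono)
    ultimately show ?thesis by linarith
  qed
  \<comment> \<open>A maximal independent set among the vertices of degree at most twice the average.\<close>
  define \<I> where "\<I> = {I. I \<subseteq> W \<and> (\<forall>x\<in>I. \<forall>y\<in>I. x \<noteq> y \<longrightarrow> \<not> r x y)}"
  have "finite \<I>" "{} \<in> \<I>" unfolding \<I>_def using finW by auto
  from finite_has_maximal2[OF this] obtain I where I: "I \<in> \<I>"
    and max: "\<forall>I'\<in>\<I>. I \<subseteq> I' \<longrightarrow> I = I'"
    by (elim bexE conjE) (rule that)
  have finI: "finite I" using I finW unfolding \<I>_def by (auto intro: finite_subset)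
  have cover: "W \<subseteq> (\<Union>x\<in>I. insert x (N x))"
  proof
    fix y assume y: "y \<in> W"
    show "y \<in> (\<Union>x\<in>I. insert x (N x))"
    proof (rule ccontr)
      assume "y \<notin> (\<Union>x\<in>I. insert x (N x))"
      then have "y \<notin> I" "\<And>x. x \<in> I \<Longrightarrow> \<not> r x y"
        using y by (auto simp: N_def W_def)
      then have "insert y I \<in> \<I>"
        using I y assms(2) unfolding \<I>_def by (auto dest: sympD)
      with max \<open>y \<notin> I\<close> show False by blast
    qed
  qed
  have "card W \<le> card (\<Union>x\<in>I. insert x (N x))"
    using finI finN by (intro card_mono[OF _ cover]) auto
  also have "\<dots> \<le> (\<Sum>x\<in>I. card (insert x (N x)))"
    using finI by (rule card_UN_le)
  also have "\<dots> \<le> (\<Sum>x\<in>I. 1 + card (N x))"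
    by (intro sum_mono) (simp add: card_insert_if finN)
  finally have "card T * card W \<le> card T * (\<Sum>x\<in>I. 1 + card (N x))" by simp
  also have "\<dots> = (\<Sum>x\<in>I. card T + card T * card (N x))"
    by (simp add: sum_distrib_left algebra_simps)
  also have "\<dots> \<le> (\<Sum>x\<in>I. card T + 2 * E)"
    using I unfolding \<I>_def W_def by (intro sum_mono) auto
  also have "\<dots> = card I * (card T + 2 * E)" by simp
  finally have "card T * (2 * card W) \<le> card I * (2 * card T + 4 * E)"
    by (simp add: algebra_simps)
  moreover have "card T ^ 2 \<le> card T * (2 * card W)"
    using half by (simp add: power2_eq_square)
  ultimately have "card T ^ 2 \<le> card I * (2 * card T + 4 * E)" by linarith
  moreover have "I \<subseteq> T" "\<forall>x\<in>I. \<forall>y\<in>I. x \<noteq> y \<longrightarrow> \<not> r x y"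
    using I unfolding \<I>_def W_def by auto
  ultimately show ?thesis unfolding E_def by blast
qed

section \<open>Vectors modulo p, zero-sum tuples and representations of sums\<close>

lemma Fp_vectors_carrier:
  assumes "p > 1"
  shows "Fp_vectors p n = {1..n} \<rightarrow>\<^sub>E {0..<int p}"
  unfolding Fp_vectors_def residue_ring_def by (rule PiE_cong) auto

lemma finite_Fp_vectors:
  assumes "p > 1"
  shows "finite (Fp_vectors p n)"
  unfolding Fp_vectors_carrier[OF assms] by (intro finite_PiE) auto

lemma card_Fp_vectors:
  assumes "p > 1"
  shows "card (Fp_vectors p n) = p ^ n"
  unfolding Fp_vectors_carrier[OF assms] by (simp add: card_PiE)

lemma Fp_vectors_eqI:
  assumes "p > 1" "u \<in> Fp_vectors p n" "v \<in> Fp_vectors p n"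
    and "\<And>c. c \<in> {1..n} \<Longrightarrow> [u c = v c] (mod int p)"
  shows "u = v"
proof (rule PiE_ext)
  show "u \<in> {1..n} \<rightarrow>\<^sub>E {0..<int p}" "v \<in> {1..n} \<rightarrow>\<^sub>E {0..<int p}"
    using assms(1-3) by (auto simp: Fp_vectors_carrier)
  then show "u c = v c" if "c \<in> {1..n}" for c
    using assms(4)[OF that] that by (auto simp: cong_def PiE_iff)
qed

text \<open>Entries may repeat, so that the induction on the number of distinct entries can start
  from constant tuples.\<close>

definition zero_sum_tuple :: "nat \<Rightarrow> nat \<Rightarrow> (nat \<Rightarrow> int) set \<Rightarrow> (nat \<Rightarrow> nat \<Rightarrow> int) \<Rightarrow> bool" where
  "zero_sum_tuple p n A x \<longleftrightarrow> x ` {1..p} \<subseteq> A \<and> (\<forall>c\<in>{1..n}. int p dvd (\<Sum>i\<in>{1..p}. x i c))"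

lemma has_zero_sum_iff:
  assumes "p > 1" "x ` {1..p} \<subseteq> Fp_vectors p n"
  shows "has_zero_sum p n x \<longleftrightarrow> (\<forall>c\<in>{1..n}. int p dvd (\<Sum>i\<in>{1..p}. x i c))"
proof -
  interpret R: residues "int p" "residue_ring (int p)"
    using assms(1) by unfold_locales auto
  have "(\<Oplus>\<^bsub>Fp p\<^esub>i\<in>{1..p}. x i c) = (\<Sum>i\<in>{1..p}. x i c) mod int p" if "c \<in> {1..n}" for c
  proof -
    have x: "x i c mod int p = x i c" "x i c \<in> carrier (Fp p)" if "i \<in> {1..p}" for i
    proof -
      have "x i \<in> {1..n} \<rightarrow>\<^sub>E {0..<int p}"
        using assms that unfolding Fp_vectors_carrier[OF assms(1), symmetric] by auto
      then have "x i c \<in> {0..<int p}" using \<open>c \<in> {1..n}\<close> by auto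
      then show "x i c mod int p = x i c" "x i c \<in> carrier (Fp p)"
        by (auto simp: R.res_carrier_eq)
    qed
    have "(\<Oplus>\<^bsub>Fp p\<^esub>i\<in>{1..p}. x i c) = (\<Oplus>\<^bsub>Fp p\<^esub>i\<in>{1..p}. x i c mod int p)"
      using x by (intro R.finsum_cong') auto
    also have "\<dots> = (\<Sum>i\<in>{1..p}. x i c) mod int p"
      by (rule R.sum_cong) simp
    finally show ?thesis .
  qed
  then show ?thesis
    unfolding has_zero_sum_def by (simp add: R.res_zero_eq dvd_eq_mod_eq_0)
qed

definition sum_reps :: "nat \<Rightarrow> nat \<Rightarrow> (nat \<Rightarrow> int) set \<Rightarrow> (nat \<Rightarrow> int) \<Rightarrow> (nat \<Rightarrow> int) \<Rightarrow>
    ((nat \<Rightarrow> int) \<times> (nat \<Rightarrow> int)) set" where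
  "sum_reps p n A x y = {(u, v) \<in> A \<times> A. \<forall>c\<in>{1..n}. [u c + v c = x c + y c] (mod int p)}"

lemma sum_reps_commute: "sum_reps p n A x y = sum_reps p n A y x"
  by (simp add: sum_reps_def add.commute)

lemma finite_sum_reps: "finite A \<Longrightarrow> finite (sum_reps p n A x y)"
  unfolding sum_reps_def by (rule finite_subset[of _ "A \<times> A"]) auto

text \<open>Group the unpopular pairs by their sum. All pairs in a group represent the same sum,
  which has fewer than \<open>K\<close> representations, and there are \<open>p ^ n\<close> possible
  sums.\<close>

lemma card_unpopular_pairs_le:
  assumes "p > 1" "A \<subseteq> Fp_vectors p n"
  shows "card {(x, y) \<in> A \<times> A. card (sum_reps p n A x y) < K} \<le> p ^ n * K"
proof -
  have finA: "finite A" using assms finite_Fp_vectors finite_subset by blast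
  define U where "U = {(x, y) \<in> A \<times> A. card (sum_reps p n A x y) < K}"
  define s where "s = (\<lambda>(x, y). restrict (\<lambda>c. (x c + y c) mod int p) {1..n} :: nat \<Rightarrow> int)"
  have finU: "finite U" unfolding U_def by (rule finite_subset[of _ "A \<times> A"]) (use finA in auto)
  have "s ` U \<subseteq> Fp_vectors p n"
    using assms(1) by (auto simp: s_def Fp_vectors_carrier)
  then have "(\<Sum>v\<in>Fp_vectors p n. \<Sum>z\<in>{z \<in> U. s z = v}. 1) = (\<Sum>z\<in>U. 1 :: nat)"
    using finU finite_Fp_vectors[OF assms(1)] by (intro sum.group) auto
  then have "card U = (\<Sum>v\<in>Fp_vectors p n. card {z \<in> U. s z = v})" by simp
  also have "\<dots> \<le> (\<Sum>v\<in>Fp_vectors p n. K)"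
  proof (rule sum_mono)
    fix v
    show "card {z \<in> U. s z = v} \<le> K"
    proof (cases "{z \<in> U. s z = v} = {}")
      case True
      show ?thesis unfolding True by simp
    next
      case False
      then obtain x y where xy: "(x, y) \<in> U" "s (x, y) = v" by auto
      have "{z \<in> U. s z = v} \<subseteq> sum_reps p n A x y"
      proof
        fix z assume z: "z \<in> {z \<in> U. s z = v}"
        obtain u w where uw: "z = (u, w)" by fastforce
        have "[u c + w c = x c + y c] (mod int p)" if "c \<in> {1..n}" for c
        proof -
          have "s (u, w) c = s (x, y) c" using z xy uw by simp
          then show ?thesis using that by (simp add: s_def cong_def)
        qed
        then show "z \<in> sum_reps p n A x y"
          using z uw unfolding sum_reps_def U_def by auto
      qed
      then have "card {z \<in> U. s z = v} \<le> card (sum_reps p n A x y)"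
        using finA by (intro card_mono finite_sum_reps)
      also have "\<dots> < K" using xy(1) by (simp add: U_def)
      finally show ?thesis by simp
    qed
  qed
  also have "\<dots> = p ^ n * K" using card_Fp_vectors[OF assms(1)] by simp
  finally show ?thesis unfolding U_def .
qed

text \<open>Either component determines a representation, so at most \<open>card Z\<close> of them
  have their first component in \<open>Z\<close>, and likewise for the second. At most one has equal
  components, because 2 is invertible modulo \<open>p\<close>. Together this excludes at most
  \<open>2 * card Z + 1\<close>.\<close>

lemma popular_sum_fresh_rep:
  assumes "p > 1" "odd p" "A \<subseteq> Fp_vectors p n" "finite Z"
    and "card (sum_reps p n A x y) \<ge> 2 * card Z + 2"
  shows "\<exists>u\<in>A - Z. \<exists>v\<in>A - Z. u \<noteq> v \<and> (\<forall>c\<in>{1..n}. [u c + v c = x c + y c] (mod int p))"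
proof (rule ccontr)
  assume no: "\<not> ?thesis"
  let ?R = "sum_reps p n A x y"
  have finA: "finite A" using assms(1,3) finite_Fp_vectors finite_subset by blast
  have fin: "finite ?R" using finA by (rule finite_sum_reps)
  have fst: "inj_on fst ?R" and snd: "inj_on snd ?R"
  proof -
    have *: "u = u' \<longleftrightarrow> v = v'" if "(u, v) \<in> ?R" "(u', v') \<in> ?R" for u v u' v'
    proof -
      have cong: "[u c + v c = u' c + v' c] (mod int p)" if "c \<in> {1..n}" for c
        using \<open>(u, v) \<in> ?R\<close> \<open>(u', v') \<in> ?R\<close> that unfolding sum_reps_def
        by (auto simp: cong_def)
      have mem: "u \<in> Fp_vectors p n" "v \<in> Fp_vectors p n" "u' \<in> Fp_vectors p n" "v' \<in> Fp_vectors p n"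
        using that assms(3) unfolding sum_reps_def by auto
      show ?thesis
      proof
        assume "u = u'"
        then have "[v c = v' c] (mod int p)" if "c \<in> {1..n}" for c
          using cong[OF that] cong_add_lcancel by blast
        then show "v = v'" using Fp_vectors_eqI[OF assms(1) mem(2,4)] by blast
      next
        assume "v = v'"
        then have "[u c = u' c] (mod int p)" if "c \<in> {1..n}" for c
          using cong[OF that] cong_add_rcancel by blast
        then show "u = u'" using Fp_vectors_eqI[OF assms(1) mem(1,3)] by blast
      qed
    qed
    show "inj_on fst ?R" by (rule inj_onI) (use * in \<open>auto simp: prod_eq_iff\<close>)
    show "inj_on snd ?R" by (rule inj_onI) (use * in \<open>auto simp: prod_eq_iff\<close>)
  qed
  define B1 where "B1 = {z \<in> ?R. fst z \<in> Z}"
  define B2 where "B2 = {z \<in> ?R. snd z \<in> Z}"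
  define B3 where "B3 = {z \<in> ?R. fst z = snd z}"
  have "?R \<subseteq> B1 \<union> B2 \<union> B3"
    using no unfolding B1_def B2_def B3_def sum_reps_def by force
  moreover have finB: "finite B1" "finite B2" "finite B3"
    unfolding B1_def B2_def B3_def using fin by auto
  ultimately have "card ?R \<le> card (B1 \<union> B2 \<union> B3)"
    by (intro card_mono) auto
  also have "\<dots> \<le> card (B1 \<union> B2) + card B3" by (rule card_Un_le)
  also have "\<dots> \<le> card B1 + card B2 + card B3" using card_Un_le[of B1 B2] by simp
  also have "card B1 \<le> card Z"
    using assms(4) by (intro card_inj_on_le[of fst]) (auto simp: B1_def intro: inj_on_subset[OF fst])
  also have "card B2 \<le> card Z"
    using assms(4) by (intro card_inj_on_le[of snd]) (auto simp: B2_def intro: inj_on_subset[OF snd])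
  also have "card B3 \<le> 1"
  proof -
    have "z = z'" if "z \<in> B3" "z' \<in> B3" for z z'
    proof -
      obtain u u' where z: "z = (u, u)" "z' = (u', u')"
        using \<open>z \<in> B3\<close> \<open>z' \<in> B3\<close> unfolding B3_def by (metis (mono_tags) mem_Collect_eq prod.collapse)
      have mem: "u \<in> Fp_vectors p n" "u' \<in> Fp_vectors p n"
        using that z assms(3) unfolding B3_def sum_reps_def by auto
      have "[u c = u' c] (mod int p)" if "c \<in> {1..n}" for c
      proof -
        have "[u c + u c = u' c + u' c] (mod int p)"
          using \<open>z \<in> B3\<close> \<open>z' \<in> B3\<close> that z unfolding B3_def sum_reps_def
          by (auto simp: cong_def)
        then have "[2 * u c = 2 * u' c] (mod int p)" by (simp only: mult_2)
        moreover have "coprime 2 (int p)" using assms(2) by simp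
        ultimately show ?thesis by (simp add: cong_mult_lcancel)
      qed
      then show ?thesis using Fp_vectors_eqI[OF assms(1) mem] z by blast
    qed
    then show ?thesis using finB(3) by (simp add: card_le_Suc0_iff_eq)
  qed
  finally show False using assms(5) by simp
qed

section \<open>Zero-sum tuples with many distinct entries\<close>

text \<open>Moving distinct entries to the first \<open>k\<close> positions matters because the
  multi-coloured theorem recombines tuples position by position: only distinctness at prescribed
  positions is inherited.\<close>

lemma zero_sum_tuple_permute:
  assumes "zero_sum_tuple p n A x" "k \<le> card (x ` {1..p})"
  shows "\<exists>x'\<in>{1..p} \<rightarrow>\<^sub>E A. zero_sum_tuple p n A x' \<and> inj_on x' {1..k}"
proof -
  obtain Y where Y: "Y \<subseteq> x ` {1..p}" "card Y = k"
    using obtain_subset_with_card_n[OF assms(2)] by metis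
  then obtain B where B: "B \<subseteq> {1..p}" "inj_on x B" "Y = x ` B"
    unfolding subset_image_inj by blast
  have finB: "finite B" using B(1) finite_subset by blast
  have cB: "card B = k" using Y(2) B(2,3) by (simp add: card_image)
  have kp: "k \<le> p" using card_mono[OF _ B(1)] cB by simp
  obtain g where g: "bij_betw g {1..k} B"
    using ex_bij_betw_nat_finite_1[OF finB] cB by blast
  have "card {k+1..p} = card ({1..p} - B)"
    using B(1) finB cB kp by (simp add: card_Diff_subset)
  then obtain h where h: "bij_betw h {k+1..p} ({1..p} - B)"
    using finite_same_card_bij[of "{k+1..p}" "{1..p} - B"] by auto
  define \<pi> where "\<pi> i = (if i \<in> {1..k} then g i else h i)" for i
  have "bij_betw \<pi> {1..k} B"
    using g by (subst bij_betw_cong[of _ _ g]) (auto simp: \<pi>_def)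
  moreover have "bij_betw \<pi> {k+1..p} ({1..p} - B)"
    using h by (subst bij_betw_cong[of _ _ h]) (auto simp: \<pi>_def)
  ultimately have "bij_betw \<pi> ({1..k} \<union> {k+1..p}) (B \<union> ({1..p} - B))"
    by (rule bij_betw_combine) auto
  moreover have "{1..k} \<union> {k+1..p} = {1..p}" "B \<union> ({1..p} - B) = {1..p}"
    using kp B(1) by auto
  ultimately have \<pi>: "bij_betw \<pi> {1..p} {1..p}" by simp
  define x' where "x' = restrict (x \<circ> \<pi>) {1..p}"
  have mem: "x' i \<in> A" if "i \<in> {1..p}" for i
  proof -
    have "\<pi> i \<in> {1..p}" using bij_betwE[OF \<pi>] that by blast
    then show ?thesis using assms(1) that unfolding zero_sum_tuple_def x'_def by auto
  qed
  have sum: "(\<Sum>i\<in>{1..p}. x' i c) = (\<Sum>i\<in>{1..p}. x i c)" for c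
  proof -
    have "(\<Sum>i\<in>{1..p}. x' i c) = (\<Sum>i\<in>{1..p}. x (\<pi> i) c)"
      by (rule sum.cong) (auto simp: x'_def)
    also have "\<dots> = (\<Sum>i\<in>{1..p}. x i c)"
      by (rule sum.reindex_bij_betw[OF \<pi>])
    finally show ?thesis .
  qed
  have "inj_on x' {1..k}"
  proof (rule inj_onI)
    fix i j assume ij: "i \<in> {1..k}" "j \<in> {1..k}" "x' i = x' j"
    then have "x (g i) = x (g j)" using kp by (auto simp: x'_def \<pi>_def)
    moreover have "g i \<in> B" "g j \<in> B" using ij bij_betwE[OF g] by blast+
    ultimately have "g i = g j" using B(2) by (simp add: inj_on_eq_iff)
    with ij show "i = j" using inj_onD[OF bij_betw_imp_inj_on[OF g]] by blast
  qed
  moreover have "x' \<in> {1..p} \<rightarrow>\<^sub>E A"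
    using mem by (intro PiE_I) (auto simp: x'_def)
  moreover have "zero_sum_tuple p n A x'"
    using assms(1) mem sum unfolding zero_sum_tuple_def by auto
  ultimately show ?thesis by blast
qed

text \<open>Take a maximal disjoint family. The part of \<open>A\<close> that it leaves uncovered
  contains no further such tuple, so it has fewer than \<open>K\<close> elements, and each member
  covers at most \<open>p\<close> elements.\<close>

lemma disjoint_zero_sum_tuples:
  fixes K :: real
  assumes "p > 0" "k \<ge> 1" "finite A"
    and ex: "\<forall>A'\<subseteq>A. K \<le> real (card A') \<longrightarrow> (\<exists>x. zero_sum_tuple p n A' x \<and> k \<le> card (x ` {1..p}))"
  shows "\<exists>T. T \<subseteq> {x \<in> {1..p} \<rightarrow>\<^sub>E A. zero_sum_tuple p n A x \<and> inj_on x {1..k}} \<and>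
    disjoint_family_on (\<lambda>x. x ` {1..p}) T \<and> real (card A) < K + p * card T"
proof -
  define \<F> where "\<F> = {x \<in> {1..p} \<rightarrow>\<^sub>E A. zero_sum_tuple p n A x \<and> inj_on x {1..k}}"
  define \<T> where "\<T> = {T. T \<subseteq> \<F> \<and> disjoint_family_on (\<lambda>x. x ` {1..p}) T}"
  have finF: "finite \<F>"
    unfolding \<F>_def using assms(3) by (intro finite_subset[OF _ finite_PiE[of "{1..p}" "\<lambda>_. A"]]) auto
  have "finite \<T>" "{} \<in> \<T>"
    unfolding \<T>_def using finF by (auto simp: disjoint_family_on_def)
  from finite_has_maximal2[OF this] obtain T where T: "T \<in> \<T>"
    and max: "\<forall>T'\<in>\<T>. T \<subseteq> T' \<longrightarrow> T = T'"
    by (elim bexE conjE) (rule that)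
  define U where "U = (\<Union>x\<in>T. x ` {1..p})"
  have finT: "finite T" using T finF unfolding \<T>_def by (auto intro: finite_subset)
  have UA: "U \<subseteq> A" using T unfolding U_def \<T>_def \<F>_def by auto
  have "real (card (A - U)) < K"
  proof (rule ccontr)
    assume "\<not> ?thesis"
    then have "K \<le> real (card (A - U))" by simp
    with ex obtain x where "zero_sum_tuple p n (A - U) x" "k \<le> card (x ` {1..p})"
      by (meson Diff_subset)
    from zero_sum_tuple_permute[OF this] obtain x'
      where x': "x' \<in> {1..p} \<rightarrow>\<^sub>E (A - U)" "zero_sum_tuple p n (A - U) x'" "inj_on x' {1..k}"
      by (elim bexE conjE) (rule that)
    have dis: "x' ` {1..p} \<inter> U = {}" using x'(1) by auto
    have "x' \<notin> T"
    proof
      assume "x' \<in> T"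
      then have "x' ` {1..p} \<subseteq> U" unfolding U_def by blast
      moreover have "x' 1 \<in> x' ` {1..p}" using assms(1) by auto
      ultimately show False using dis by blast
    qed
    moreover have "x' \<in> \<F>" using x' unfolding \<F>_def zero_sum_tuple_def by auto
    moreover have "disjoint_family_on (\<lambda>x. x ` {1..p}) (insert x' T)"
      using T dis \<open>x' \<notin> T\<close> unfolding \<T>_def U_def by (simp add: disjoint_family_on_insert)
    ultimately have "insert x' T \<in> \<T>" using T unfolding \<T>_def by simp
    with max \<open>x' \<notin> T\<close> show False by blast
  qed
  moreover have "card A \<le> card (A - U) + card U"
    using assms(3) UA by (simp add: card_Diff_subset finite_subset)
  moreover have "card U \<le> p * card T"
  proof -
    have "card U \<le> (\<Sum>x\<in>T. card (x ` {1..p}))"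
      unfolding U_def using finT by (rule card_UN_le)
    also have "\<dots> \<le> (\<Sum>x\<in>T. p)"
      using card_image_le[of "{1..p}"] by (intro sum_mono) simp
    finally show ?thesis by (simp add: mult.commute)
  qed
  ultimately have "real (card A) < K + real (p * card T)"
    by linarith
  then have "real (card A) < K + p * card T" by simp
  with T show ?thesis unfolding \<T>_def \<F>_def by blast
qed

text \<open>In \<open>large\<close> the first factor is the threshold of the multi-coloured theorem,
  and the second bounds \<open>2 * card T\<close> plus four times the number of edges of the
  unpopularity graph on \<open>T\<close>. The independent set therefore exceeds the
  threshold.\<close>

lemma more_distinct_entries:
  assumes p: "prime p" "odd p" and A: "A \<subseteq> Fp_vectors p n" and k: "1 \<le> k" "k < p"
    and T: "T \<subseteq> {x \<in> {1..p} \<rightarrow>\<^sub>E A. zero_sum_tuple p n A x \<and> inj_on x {1..k}}"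
    and disj: "disjoint_family_on (\<lambda>x. x ` {1..p}) T"
    and large: "card T ^ 2 > (p * card (low_exponents p n)) * (2 * p ^ n + 4 * (p ^ 2 * (p ^ n * (2 * p + 2))))"
  shows "\<exists>x. zero_sum_tuple p n A x \<and> k + 1 \<le> card (x ` {1..p})"
proof -
  have p1: "p > 1" using p(1) prime_gt_1_nat by blast
  have finA: "finite A" using A finite_Fp_vectors[OF p1] by (rule finite_subset)
  have finT: "finite T"
    using T finA by (intro finite_subset[OF _ finite_PiE[of "{1..p}" "\<lambda>_. A"]]) auto
  have TA: "x i \<in> A" if "x \<in> T" "i \<in> {1..p}" for x i
    using T that by (blast intro: PiE_mem)
  have same: "x = y" if "x \<in> T" "y \<in> T" "i \<in> {1..p}" "j \<in> {1..p}" "x i = y j" for x y i j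
  proof (rule ccontr)
    assume "x \<noteq> y"
    then have "x ` {1..p} \<inter> y ` {1..p} = {}"
      using disjoint_family_onD[OF disj] that(1,2) by blast
    then show False using that(3-5) by blast
  qed
  \<comment> \<open>The threshold \<open>2 * p + 2\<close> leaves room to avoid the at most
    \<open>p\<close> values of a tuple when a pair is replaced.\<close>
  define r where "r x y \<longleftrightarrow> (\<exists>a\<in>{1..p}. \<exists>b\<in>{1..p}. card (sum_reps p n A (x a) (y b)) < 2 * p + 2)" for x y
  have "symp r"
    unfolding r_def using sum_reps_commute[of p n A] by (intro sympI) metis
  \<comment> \<open>For fixed positions \<open>a\<close> and \<open>b\<close>, disjointness makes
    \<open>(x a, y b)\<close> determine \<open>(x, y)\<close>, so the edges of this type embed into
    the unpopular pairs.\<close>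
  have edges: "card {(x, y) \<in> T \<times> T. r x y} \<le> p ^ 2 * (p ^ n * (2 * p + 2))"
  proof -
    define S where "S = (\<lambda>(a, b). {(x, y) \<in> T \<times> T. card (sum_reps p n A (x a) (y b)) < 2 * p + 2})"
    have "card (S ab) \<le> p ^ n * (2 * p + 2)" if ab: "ab \<in> {1..p} \<times> {1..p}" for ab
    proof -
      obtain a b where ab': "ab = (a, b)" "a \<in> {1..p}" "b \<in> {1..p}" using ab by auto
      have "card (S ab) \<le> card {(u, v) \<in> A \<times> A. card (sum_reps p n A u v) < 2 * p + 2}"
      proof (rule card_inj_on_le)
        show "inj_on (\<lambda>(x, y). (x a, y b)) (S ab)"
        proof (rule inj_onI, clarify)
          fix x y x' y' assume S: "(x, y) \<in> S ab" "(x', y') \<in> S ab" and eq: "x a = x' a" "y b = y' b"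
          then have "x \<in> T" "y \<in> T" "x' \<in> T" "y' \<in> T" by (auto simp: S_def ab')
          then show "x = x' \<and> y = y'"
            using same[of x x' a a] same[of y y' b b] ab' eq by auto
        qed
        show "(\<lambda>(x, y). (x a, y b)) ` S ab \<subseteq> {(u, v) \<in> A \<times> A. card (sum_reps p n A u v) < 2 * p + 2}"
          using TA ab' by (auto simp: S_def)
        show "finite {(u, v) \<in> A \<times> A. card (sum_reps p n A u v) < 2 * p + 2}"
          by (rule finite_subset[of _ "A \<times> A"]) (use finA in auto)
      qed
      also have "\<dots> \<le> p ^ n * (2 * p + 2)"
        by (rule card_unpopular_pairs_le[OF p1 A])
      finally show ?thesis .
    qed
    then have le: "(\<Sum>ab\<in>{1..p} \<times> {1..p}. card (S ab)) \<le> (\<Sum>ab\<in>{1..p} \<times> {1..p}. p ^ n * (2 * p + 2))"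
      by (rule sum_mono)
    have "{(x, y) \<in> T \<times> T. r x y} = (\<Union>ab\<in>{1..p} \<times> {1..p}. S ab)"
      by (auto simp: r_def S_def)
    then have "card {(x, y) \<in> T \<times> T. r x y} \<le> (\<Sum>ab\<in>{1..p} \<times> {1..p}. card (S ab))"
      using card_UN_le[of "{1..p} \<times> {1..p}" S] by simp
    also note le
    finally show ?thesis by (simp add: power2_eq_square)
  qed
  have "card T \<le> p ^ n"
  proof -
    have "card T \<le> card A"
    proof (rule card_inj_on_le[of "\<lambda>x. x 1"])
      show "inj_on (\<lambda>x. x 1) T"
        using same[of _ _ 1 1] p1 by (auto simp: inj_on_def)
      show "(\<lambda>x. x 1) ` T \<subseteq> A" using TA p1 by auto
    qed (rule finA)
    also have "\<dots> \<le> p ^ n"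
      using card_mono[OF finite_Fp_vectors[OF p1] A] card_Fp_vectors[OF p1] by simp
    finally show ?thesis .
  qed
  obtain I where I: "I \<subseteq> T" "\<forall>x\<in>I. \<forall>y\<in>I. x \<noteq> y \<longrightarrow> \<not> r x y"
    "card T ^ 2 \<le> card I * (2 * card T + 4 * card {(x, y) \<in> T \<times> T. r x y})"
    using large_independent_set[OF finT \<open>symp r\<close>] by (elim exE conjE) (rule that)
  have "card T ^ 2 \<le> card I * (2 * p ^ n + 4 * (p ^ 2 * (p ^ n * (2 * p + 2))))"
    by (rule order_trans[OF I(3)]) (intro mult_left_mono add_mono edges \<open>card T \<le> p ^ n\<close>; simp)
  with large have "(p * card (low_exponents p n)) * (2 * p ^ n + 4 * (p ^ 2 * (p ^ n * (2 * p + 2))))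
      < card I * (2 * p ^ n + 4 * (p ^ 2 * (p ^ n * (2 * p + 2))))"
    by linarith
  then have cI: "p * card (low_exponents p n) < card I"
    by (rule mult_less_cancel2[THEN iffD1, THEN conjunct2])
  have diag: "\<forall>x\<in>I. \<forall>c\<in>{1..n}. int p dvd (\<Sum>i\<in>{1..p}. x i c)"
    using I(1) T unfolding zero_sum_tuple_def by blast
  obtain f a0 b0 where f: "f \<in> {1..p} \<rightarrow> I" "\<forall>c\<in>{1..n}. int p dvd (\<Sum>i\<in>{1..p}. f i i c)"
    "a0 \<in> {1..p}" "b0 \<in> {1..p}" "f a0 \<noteq> f b0"
    using multicolored_zero_sum[where y = "\<lambda>i x. x i", OF p(1) finite_subset[OF I(1) finT] cI diag]
    by (elim bexE conjE) (rule that)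
  define z where "z i = f i i" for i
  have fI: "f i \<in> I" "f i \<in> T" if "i \<in> {1..p}" for i
    using f(1) I(1) that by auto
  have zA: "z i \<in> A" if "i \<in> {1..p}" for i
    using TA fI that by (simp add: z_def)
  have z_eq: "f i = f j" if "z i = z j" "i \<in> {1..p}" "j \<in> {1..p}" for i j
    using same[of "f i" "f j" i j] fI that by (simp add: z_def)
  \<comment> \<open>Equal entries of \<open>z\<close> come from the same tuple of \<open>T\<close>
    by disjointness, and the first \<open>k\<close> entries of that tuple are distinct.\<close>
  have "inj_on z {1..k}"
  proof (rule inj_onI)
    fix i j assume ij: "i \<in> {1..k}" "j \<in> {1..k}" "z i = z j"
    then have "i \<in> {1..p}" "j \<in> {1..p}" using k by auto
    then have fij: "f i = f j" and "f i \<in> T" using z_eq[OF ij(3)] fI(2) by blast+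
    then have "inj_on (f i) {1..k}" using T by blast
    moreover have "f i i = f i j" using ij(3) unfolding z_def fij .
    ultimately show "i = j" using ij(1,2) by (blast dest: inj_onD)
  qed
  then have ck: "k \<le> card (z ` {1..p})"
    using card_image[of z "{1..k}"] card_mono[OF _ image_mono[of "{1..k}" "{1..p}" z]] k by simp
  have zs: "zero_sum_tuple p n A z"
    using zA f(2) unfolding zero_sum_tuple_def z_def by auto
  show ?thesis
  proof (cases "inj_on z {1..p}")
    case True
    then have "k + 1 \<le> card (z ` {1..p})" using k by (simp add: card_image)
    with zs show ?thesis by blast
  next
    case False
    then obtain a b where ab: "a \<in> {1..p}" "b \<in> {1..p}" "a \<noteq> b" "z a = z b"
      by (auto simp: inj_on_def)
    have fab: "f a = f b" using z_eq ab by blast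
    \<comment> \<open>Such a \<open>c\<close> exists because \<open>f\<close> is not constant; as
      \<open>f a\<close> and \<open>f c\<close> are then different members of \<open>I\<close>, the
      pair \<open>(z a, z c)\<close> is popular.\<close>
    obtain c where c: "c \<in> {1..p}" "f c \<noteq> f a"
      using f(3-5) by metis
    have "\<not> r (f a) (f c)" using I(2) fI(1)[OF ab(1)] fI(1)[OF c(1)] c(2) by metis
    then have "card (sum_reps p n A (z a) (z c)) \<ge> 2 * p + 2"
      using ab(1) c(1) unfolding r_def z_def by (meson not_le)
    moreover have "card (z ` {1..p}) \<le> p" using card_image_le[of "{1..p}" z] by simp
    ultimately have "card (sum_reps p n A (z a) (z c)) \<ge> 2 * card (z ` {1..p}) + 2" by linarith
    from popular_sum_fresh_rep[OF p1 p(2) A finite_imageI[OF finite_atLeastAtMost] this] obtain u v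
      where uv: "u \<in> A - z ` {1..p}" "v \<in> A - z ` {1..p}" "u \<noteq> v"
        "\<forall>d\<in>{1..n}. [u d + v d = z a d + z c d] (mod int p)"
      by (elim bexE conjE) (rule that)
    define z' where "z' = z(a := u, c := v)"
    have ac: "a \<noteq> c" "b \<noteq> c" "b \<noteq> a" using c fab ab(3) by auto
    have z': "z' a = u" "z' c = v" "\<And>i. i \<noteq> a \<Longrightarrow> i \<noteq> c \<Longrightarrow> z' i = z i"
      using ac by (auto simp: z'_def)
    have "int p dvd (\<Sum>i\<in>{1..p}. z' i d)" if d: "d \<in> {1..n}" for d
    proof -
      have split: "(\<Sum>i\<in>{1..p}. w i d) = w a d + (w c d + (\<Sum>i\<in>{1..p} - {a} - {c}. w i d))"
        for w :: "nat \<Rightarrow> nat \<Rightarrow> int"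
        by (subst sum.remove[of _ a], use ab(1) in simp_all, subst sum.remove[of _ c], use c(1) ac in simp_all)
      have "(\<Sum>i\<in>{1..p} - {a} - {c}. z' i d) = (\<Sum>i\<in>{1..p} - {a} - {c}. z i d)"
        by (intro sum.cong refl) (auto simp: z')
      then have "(\<Sum>i\<in>{1..p}. z' i d) = (\<Sum>i\<in>{1..p}. z i d) + (u d + v d - (z a d + z c d))"
        unfolding split[of z'] split[of z] by (simp add: z')
      moreover have "int p dvd (\<Sum>i\<in>{1..p}. z i d)"
        using zs d unfolding zero_sum_tuple_def by blast
      moreover have "int p dvd u d + v d - (z a d + z c d)"
        using uv(4) d by (simp add: cong_iff_dvd_diff)
      ultimately show ?thesis by simp
    qed
    moreover have "z' ` {1..p} \<subseteq> A"
      using zA uv by (auto simp: z'_def)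
    ultimately have "zero_sum_tuple p n A z'" unfolding zero_sum_tuple_def by blast
    moreover have "k + 1 \<le> card (z' ` {1..p})"
    proof -
      \<comment> \<open>The overwritten value \<open>z a\<close> is still present at position
        \<open>b\<close>, so at most \<open>z c\<close> is lost while \<open>u\<close> and
        \<open>v\<close> are new.\<close>
      have sub: "insert u (insert v (z ` {1..p} - {z c})) \<subseteq> z' ` {1..p}"
      proof
        fix w assume "w \<in> insert u (insert v (z ` {1..p} - {z c}))"
        then consider "w = u" | "w = v" | i where "i \<in> {1..p}" "w = z i" "z i \<noteq> z c" by auto
        then show "w \<in> z' ` {1..p}"
        proof cases
          case 1
          then show ?thesis using ab(1) z'(1) by blast
        next
          case 2
          then show ?thesis using c(1) z'(2) by blast
        next
          case (3 i)
          show ?thesis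
          proof (cases "i = a")
            case True
            then have "w = z' b" using 3 ab(4) z'(3)[of b] ac by auto
            then show ?thesis using ab(2) by blast
          next
            case False
            moreover have "i \<noteq> c" using 3(3) by auto
            ultimately have "w = z' i" using 3(2) z'(3)[of i] by simp
            then show ?thesis using 3(1) by blast
          qed
        qed
      qed
      have "card (insert u (insert v (z ` {1..p} - {z c}))) = Suc (Suc (card (z ` {1..p} - {z c})))"
        using uv(1-3) by auto
      also have "card (z ` {1..p} - {z c}) = card (z ` {1..p}) - 1"
        using c(1) by (simp add: card_Diff_singleton)
      finally have "k + 1 \<le> card (insert u (insert v (z ` {1..p} - {z c})))"
        using ck by linarith
      also have "\<dots> \<le> card (z' ` {1..p})"
        by (intro card_mono sub) simp
      finally show ?thesis .
    qed
    ultimately show ?thesis by blast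
  qed
qed

text \<open>Induction on \<open>k\<close>, starting from a constant tuple, which has zero sum modulo
  \<open>p\<close>. The threshold grows by \<open>p * b * D\<close> per step, where
  \<open>D = sqrt (gamma_p p * p) ^ n\<close>: this surplus forces more than \<open>b * D\<close>
  disjoint tuples, and \<open>b\<close> is chosen so that this suffices for
  \<open>more_distinct_entries\<close>.\<close>

lemma zero_sum_tuple_many_distinct:
  fixes p k n :: nat
  assumes p: "prime p" "p \<ge> 5" and k: "1 \<le> k" "k \<le> p" and A: "A \<subseteq> Fp_vectors p n"
    and b: "b = real p * (2 + 4 * (p ^ 2 * (2 * p + 2)))"
    and large: "real (card A) \<ge> (1 + (real k - 1) * p * b) * sqrt (gamma_p p * p) ^ n"
  shows "\<exists>x. zero_sum_tuple p n A x \<and> k \<le> card (x ` {1..p})"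
proof -
  define D where "D = sqrt (gamma_p p * p) ^ n"
  have g: "1 \<le> gamma_p p" using gamma_p_attained[OF p(2)] by metis
  have "1 * 1 \<le> gamma_p p * real p" using g p by (intro mult_mono) auto
  then have D1: "1 \<le> D" unfolding D_def by (simp add: one_le_power)
  have D2: "D ^ 2 = gamma_p p ^ n * real p ^ n"
    using \<open>1 * 1 \<le> gamma_p p * real p\<close>
    by (simp add: D_def power_mult_distrib flip: power_mult power_mult_distrib real_sqrt_power)
      (simp add: mult.commute power_mult)
  have odd: "odd p" using p prime_odd_nat by force
  show ?thesis
    using k A large[folded D_def]
  proof (induction k arbitrary: A rule: nat_induct_at_least)
    case base
    then have "A \<noteq> {}" using D1 by auto
    then obtain a where "a \<in> A" by blast
    then have "zero_sum_tuple p n A (\<lambda>_. a)" by (auto simp: zero_sum_tuple_def)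
    moreover have "1 \<le> card ((\<lambda>_. a) ` {1..p})" using p by (simp add: image_constant_conv)
    ultimately show ?case by blast
  next
    case (Suc k)
    have finA: "finite A"
      using Suc.prems(2) finite_Fp_vectors[of p n] p by (simp add: finite_subset)
    define K where "K = (1 + (real k - 1) * p * b) * D"
    have ex: "\<forall>A'\<subseteq>A. K \<le> real (card A') \<longrightarrow> (\<exists>x. zero_sum_tuple p n A' x \<and> k \<le> card (x ` {1..p}))"
    proof (intro allI impI)
      fix A' assume "A' \<subseteq> A" "K \<le> real (card A')"
      then show "\<exists>x. zero_sum_tuple p n A' x \<and> k \<le> card (x ` {1..p})"
        using Suc.prems(1,2) unfolding K_def by (intro Suc.IH) auto
    qed
    have "p > 0" using p by simp
    from disjoint_zero_sum_tuples[OF this Suc.hyps finA ex] obtain T where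
      T: "T \<subseteq> {x \<in> {1..p} \<rightarrow>\<^sub>E A. zero_sum_tuple p n A x \<and> inj_on x {1..k}}"
      and disj: "disjoint_family_on (\<lambda>x. x ` {1..p}) T"
      and cT: "real (card A) < K + p * card T"
      by (elim exE conjE) (rule that)
    have "K + p * b * D \<le> real (card A)"
      using Suc.prems(3) unfolding K_def by (simp add: algebra_simps)
    with cT have "p * (b * D) < p * real (card T)" by (simp add: mult.assoc)
    then have "b * D < real (card T)"
      using p by (simp only: mult_less_cancel_left_pos of_nat_0_less_iff)
    moreover have b0: "b > 0" using p by (simp add: b add_pos_nonneg)
    ultimately have "(b * D) ^ 2 < real (card T) ^ 2"
      using D1 by (intro power_strict_mono) auto
    \<comment> \<open>Here \<open>D ^ 2\<close> absorbs both \<open>gamma_p p ^ n\<close>, which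
      bounds the number of low exponents, and \<open>p ^ n\<close>. This is the source of the square
      root in the bound.\<close>
    moreover have "real p * b * (card (low_exponents p n) * real p ^ n) \<le> (b * D) ^ 2 "
    proof -
      have "real p * 1 \<le> b"
        unfolding b by (intro mult_left_mono) auto
      then have pb: "real p * b \<le> b * b" using b0 by simp
      have M: "card (low_exponents p n) * real p ^ n \<le> gamma_p p ^ n * real p ^ n"
        using card_low_exponents_le_gamma_p[OF p(2)] by (intro mult_right_mono) auto
      have "real p * b * (card (low_exponents p n) * real p ^ n) \<le> b * b * (gamma_p p ^ n * real p ^ n)"
        by (rule mult_mono[OF pb M]) (use b0 in simp_all)
      then show ?thesis by (simp add: power_mult_distrib D2 power2_eq_square[of b])
    qed
    moreover have "real ((p * card (low_exponents p n)) * (2 * p ^ n + 4 * (p ^ 2 * (p ^ n * (2 * p + 2)))))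
        \<le> real p * b * (card (low_exponents p n) * real p ^ n)"
    proof -
      have "real ((p * card (low_exponents p n)) * (2 * p ^ n + 4 * (p ^ 2 * (p ^ n * (2 * p + 2)))))
          = b * (card (low_exponents p n) * real p ^ n)"
        by (simp add: b algebra_simps)
      also have "\<dots> \<le> real p * (b * (card (low_exponents p n) * real p ^ n))"
        using mult_right_mono[of 1 "real p" "b * (card (low_exponents p n) * real p ^ n)"] b0 p by simp
      finally show ?thesis by (simp add: mult.assoc)
    qed
    ultimately have "real ((p * card (low_exponents p n)) * (2 * p ^ n + 4 * (p ^ 2 * (p ^ n * (2 * p + 2)))))
        < real (card T ^ 2)"
      by simp
    then have "(p * card (low_exponents p n)) * (2 * p ^ n + 4 * (p ^ 2 * (p ^ n * (2 * p + 2)))) < card T ^ 2"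
      by (simp only: of_nat_less_iff)
    from more_distinct_entries[OF p(1) odd Suc.prems(2) Suc.hyps _ T disj this] Suc.prems(1)
    show ?case by simp
  qed
qed

theorem theorem1p1:
  fixes p :: nat
  assumes "prime p" and "p \<ge> 5"
  shows "\<exists>C::real. \<forall>n\<ge>1. \<forall>A \<subseteq> Fp_vectors p n.
    \<not> (\<exists>x. inj_on x {1..p} \<and> x ` {1..p} \<subseteq> A \<and> has_zero_sum p n x) \<longrightarrow>
      real (card A) \<le> C * sqrt (gamma_p p * real p) ^ n \<and>
      C * sqrt (gamma_p p * real p) ^ n < C * (2 * sqrt (real p)) ^ n"
proof -
  define b where "b = real p * (2 + 4 * (p ^ 2 * (2 * p + 2)))"
  \<comment> \<open>The coefficient of the threshold at \<open>k = p\<close>, where \<open>p\<close>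
    distinct values among \<open>p\<close> entries force injectivity.\<close>
  define C where "C = 1 + (real p - 1) * p * b"
  have p1: "p > 1" using assms(2) by simp
  have C: "C > 0"
    unfolding C_def b_def using assms(2) by (intro add_pos_nonneg mult_nonneg_nonneg) auto
  have g: "1 \<le> gamma_p p" "gamma_p p < 4" using gamma_p_attained[OF assms(2)] by metis+
  show ?thesis
  proof (intro exI[of _ C] allI impI conjI)
    fix n :: nat and A
    assume n: "n \<ge> 1" and A: "A \<subseteq> Fp_vectors p n"
      and no: "\<not> (\<exists>x. inj_on x {1..p} \<and> x ` {1..p} \<subseteq> A \<and> has_zero_sum p n x)"
    show "real (card A) \<le> C * sqrt (gamma_p p * real p) ^ n"
    proof (rule ccontr)
      assume "\<not> ?thesis"
      then have "C * sqrt (gamma_p p * real p) ^ n \<le> real (card A)" by simp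
      then obtain x where x: "zero_sum_tuple p n A x" "p \<le> card (x ` {1..p})"
        using zero_sum_tuple_many_distinct[OF assms _ order_refl A b_def] p1 unfolding C_def by auto
      have "card (x ` {1..p}) = card {1..p}"
        using x(2) card_image_le[of "{1..p}" x] by simp
      then have "inj_on x {1..p}" by (intro eq_card_imp_inj_on) auto
      moreover have "x ` {1..p} \<subseteq> A" "has_zero_sum p n x"
        using x(1) A has_zero_sum_iff[OF p1, of x n] unfolding zero_sum_tuple_def by auto
      ultimately show False using no by blast
    qed
    \<comment> \<open>The strict bound \<open>gamma_p p < 4\<close> gives the second inequality;
      strictness survives the \<open>n\<close>-th power since \<open>n\<close> is positive.\<close>
    have "sqrt (gamma_p p * real p) < sqrt (4 * real p)"
      using g p1 by simp
    also have "\<dots> = 2 * sqrt (real p)" by (simp add: real_sqrt_mult)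
    finally have "sqrt (gamma_p p * real p) ^ n < (2 * sqrt (real p)) ^ n"
      using n g by (intro power_strict_mono) auto
    then show "C * sqrt (gamma_p p * real p) ^ n < C * (2 * sqrt (real p)) ^ n"
      using C by simp
  qed
qed

end
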